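(* Let $G$ be a graph with independence number $\beta_0(G)=2$ and vertex set $V(G)=\{x_1,\ldots,x_n\}$, and let $S=K[x_1,\ldots,x_n]$ be a polynomial ring over a field $K$. Then $S/I(G)$ has a 0-1 linear system of parameters if and only if $V(G)$ has a partition into three or into two cliques of $G$. In particular, if $\overline{G}$ is the complement of $G$ and $\chi(\overline{G})>3$, then $S/I(G)$ does not have a 0-1 linear system of parameters.
   Context: Graphs are finite and simple; vertices are identified with the variables of $S$. The edge ideal of $G$ is $I(G)=(x_ix_j \mid \{x_i,x_j\}\in E(G))\subset S$. The independence number $\beta_0(G)$ is the largest size of an independent set of vertices; it equals $\dim(S/I(G))$. A clique of $G$ is a subset $A\subset V(G)$ such that the induced subgraph $G[A]$ is complete. $\chi$ denotes the chromatic number. With $\mathfrak m=(x_1,\ldots,x_n)$, linear forms $f_1,\ldots,f_d\in S$ form a linear system of parameters for $S/I(G)$ if $d=\dim(S/I(G))$ and $\mathrm{rad}(I(G),f_1,\ldots,f_d)=\mathfrak m$; it is a 0-1 linear system of parameters if all coefficients of the $f_i$ lie in $\{0,1\}\subset K$. *)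

theory Defs
  imports
    "HOL-Library.Poly_Mapping"
    "HOL-Library.Ramsey"
    "HOL-Library.Disjoint_Sets"
    "HOL-Library.Extended_Nat"
    "HOL-Algebra.QuotRing"
    "HOL-Algebra.Algebraic_Closure_Type"
begin

section \<open>Graphs\<close>

text \<open>A finite simple graph is given by its edge set on a vertex type of class \<open>finite\<close>; the
  vertex set is \<open>UNIV\<close>. Cliques and independent sets are \<open>clique\<close> and \<open>indep\<close> from
  \<open>HOL-Library.Ramsey\<close>.\<close>

definition simple_graph :: "'v::finite set set \<Rightarrow> bool" where
  "simple_graph E \<longleftrightarrow> (\<forall>e\<in>E. card e = 2)"

definition complement_graph :: "'v::finite set set \<Rightarrow> 'v set set" where
  "complement_graph E = {e. card e = 2 \<and> e \<notin> E}"

definition independence_number :: "'v::finite set set \<Rightarrow> nat" where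
  "independence_number E = Max {card A | A. indep A E}"

definition chromatic_number :: "'v::finite set set \<Rightarrow> nat" where
  "chromatic_number E =
    (LEAST k. \<exists>c :: 'v \<Rightarrow> nat. (\<forall>v. c v < k) \<and> (\<forall>u v. {u, v} \<in> E \<longrightarrow> c u \<noteq> c v))"

definition clique_partition :: "'v::finite set set \<Rightarrow> 'v set set \<Rightarrow> bool" where
  "clique_partition E P \<longleftrightarrow> partition_on UNIV P \<and> (\<forall>A\<in>P. clique A E)"


section \<open>Radicals and Krull dimension\<close>

definition radical :: "('a, 'b) ring_scheme \<Rightarrow> 'a set \<Rightarrow> 'a set" where
  "radical R I = {x \<in> carrier R. \<exists>n::nat. x [^]\<^bsub>R\<^esub> n \<in> I}"

text \<open>The supremum of the lengths \<open>n\<close> of chains \<open>P 0 \<subset> \<dots> \<subset> P n\<close> of prime ideals; the value for the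
  zero ring is \<open>0\<close> here.\<close>

definition krull_dim :: "('a, 'b) ring_scheme \<Rightarrow> enat" where
  "krull_dim R = Sup {enat n | n. \<exists>P :: nat \<Rightarrow> 'a set.
     (\<forall>i\<le>n. primeideal (P i) R) \<and> (\<forall>i<n. P i \<subset> P (Suc i))}"


section \<open>The polynomial ring and edge ideals\<close>

text \<open>The polynomials over \<open>'k\<close> in one variable for each element of \<open>'v\<close>, as finitely supported
  functions from exponent vectors to coefficients.\<close>

type_synonym ('v, 'k) mpoly = "('v \<Rightarrow>\<^sub>0 nat) \<Rightarrow>\<^sub>0 'k"

definition mpoly_ring :: "('v::finite, 'k::field) mpoly ring" where
  "mpoly_ring = ring_of_type_algebra"

definition Var :: "'v::finite \<Rightarrow> ('v, 'k::field) mpoly" where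
  "Var v = Poly_Mapping.single (Poly_Mapping.single v 1) 1"

definition Const :: "'k::field \<Rightarrow> ('v::finite, 'k) mpoly" where
  "Const a = Poly_Mapping.single 0 a"

definition edge_ideal :: "'v::finite set set \<Rightarrow> ('v, 'k::field) mpoly set" where
  "edge_ideal E = Idl\<^bsub>mpoly_ring\<^esub> {Var u * Var v | u v. {u, v} \<in> E}"

definition irrelevant_ideal :: "('v::finite, 'k::field) mpoly set" where
  "irrelevant_ideal = Idl\<^bsub>mpoly_ring\<^esub> (range Var)"


section \<open>Linear systems of parameters\<close>

definition linear_form :: "('v::finite, 'k::field) mpoly \<Rightarrow> bool" where
  "linear_form f \<longleftrightarrow> (\<exists>c. f = (\<Sum>v\<in>UNIV. Const (c v) * Var v))"

definition linear_sop :: "('v::finite, 'k::field) mpoly set \<Rightarrow> ('v, 'k) mpoly list \<Rightarrow> bool" where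
  "linear_sop I fs \<longleftrightarrow>
     (\<forall>f\<in>set fs. linear_form f) \<and>
     enat (length fs) = krull_dim (mpoly_ring Quot I) \<and>
     radical mpoly_ring (Idl\<^bsub>mpoly_ring\<^esub> (I \<union> set fs)) = irrelevant_ideal"

definition zero_one_linear_sop ::
    "('v::finite, 'k::field) mpoly set \<Rightarrow> ('v, 'k) mpoly list \<Rightarrow> bool" where
  "zero_one_linear_sop I fs \<longleftrightarrow>
     linear_sop I fs \<and> (\<forall>f\<in>set fs. \<forall>m. Poly_Mapping.lookup f m \<in> {0, 1})"

end

theory Submission
  imports Defs
begin

text \<open>The dimension is two: a prime containing \<open>I(G)\<close> contains all variables outside an
  independent set, so modulo it three polynomials are algebraically dependent, and the term of a
  dependence that is lexicographically lowest in elements \<open>a\<^sub>i \<in> P\<^sub>i\<^sub>+\<^sub>1 - P\<^sub>i\<close> would put a unit into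
  \<open>P\<^sub>3\<close> of a chain \<open>P\<^sub>0 \<subset> P\<^sub>1 \<subset> P\<^sub>2 \<subset> P\<^sub>3\<close>.

  Given a 0-1 system of parameters \<open>f\<^sub>1, f\<^sub>2\<close>, evaluation at points supported on an independent set
  shows that the vectors of coefficients of \<open>x\<^sub>v\<close> in \<open>f\<^sub>1, f\<^sub>2\<close> are nonzero and differ for
  non-adjacent vertices; the three possible values \<open>(1, 0)\<close>, \<open>(0, 1)\<close>, \<open>(1, 1)\<close> then cut the graph into
  cliques. Conversely, a partition into cliques with sums of variables \<open>s\<^sub>0, s\<^sub>1, s\<^sub>2\<close> gives the
  parameters \<open>s\<^sub>0 + s\<^sub>2\<close> and \<open>s\<^sub>1 + s\<^sub>2\<close>.\<close>

section \<open>Prime ideals of quotient rings\<close>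

text \<open>An ideal of the quotient is a set of cosets, so its union is its preimage under the
  projection, and primality is pulled back along that homomorphism.\<close>

lemma (in cring) primeideal_Union_quotient:
  assumes I: "ideal I R" and P: "primeideal P (R Quot I)"
  shows "primeideal (\<Union>P) R"
proof -
  interpret P: primeideal P "R Quot I" by fact
  have PC: "P \<subseteq> carrier (R Quot I)" by (rule P.a_subset)
  note iff = canonical_proj_vimage_mem_iff[OF I PC]
  have carr: "I +> a \<in> carrier (R Quot I)" if "a \<in> carrier R" for a
    using ideal.rcos_ring_hom[OF I] that by (auto simp: ring_hom_def)
  show ?thesis
  proof (rule primeidealI)
    show "ideal (\<Union>P) R"
      using quot_ideal_imp_ring_ideal[OF I] P.is_ideal by blast
    show "carrier R \<noteq> \<Union>P"
    proof
      assume "carrier R = \<Union>P"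
      then have "I +> \<one> \<in> P" using iff[of \<one>] by auto
      then have "\<one>\<^bsub>R Quot I\<^esub> \<in> P" by (simp add: FactRing_def)
      then show False using P.one_imp_carrier P.I_notcarr by blast
    qed
    fix a b assume ab: "a \<in> carrier R" "b \<in> carrier R" "a \<otimes> b \<in> \<Union>P"
    then have "I +> (a \<otimes> b) \<in> P" using iff by auto
    then have "(I +> a) \<otimes>\<^bsub>R Quot I\<^esub> (I +> b) \<in> P"
      using ideal.rcoset_mult_add[OF I ab(1,2)] by (simp add: FactRing_def)
    then show "a \<in> \<Union>P \<or> b \<in> \<Union>P"
      using P.I_prime carr ab iff by metis
  qed (rule is_cring)
qed

lemma (in cring) primeideal_image_quotient:
  assumes I: "ideal I R" and Q: "primeideal Q R" and "I \<subseteq> Q"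
  shows "primeideal ((+>) I ` Q) (R Quot I)"
proof -
  interpret Q: primeideal Q R by fact
  have id: "ideal ((+>) I ` Q) (R Quot I)"
    by (rule ring_ideal_imp_quot_ideal[OF I Q.is_ideal])
  \<comment> \<open>\<open>Q\<close> is a union of cosets because it contains \<open>I\<close>;
    membership of \<open>a\<close> in \<open>Q\<close> can therefore be tested on the coset of
    \<open>a\<close>.\<close>
  have Un: "\<Union> ((+>) I ` Q) = Q"
    using ideal_incl_iff[OF I Q.is_ideal] \<open>I \<subseteq> Q\<close> by blast
  have sub: "(+>) I ` Q \<subseteq> carrier (R Quot I)"
    using ideal.axioms(1)[OF id] by (rule additive_subgroup.a_subset)
  note iff = canonical_proj_vimage_mem_iff[OF I sub, unfolded Un]
  have rep: "\<exists>a\<in>carrier R. x = I +> a" if "x \<in> carrier (R Quot I)" for x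
    using that unfolding FactRing_def using A_RCOSETS_def'[of R I] by auto
  show ?thesis
  proof (rule primeidealI[OF id ideal.quotient_is_cring[OF I is_cring]])
    show "carrier (R Quot I) \<noteq> (+>) I ` Q"
    proof
      assume *: "carrier (R Quot I) = (+>) I ` Q"
      have "I +> \<one> \<in> carrier (R Quot I)"
        using ring_hom_closed[OF ideal.rcos_ring_hom[OF I]] by blast
      then have "\<one> \<in> Q" using iff[of \<one>] * by simp
      then show False using Q.one_imp_carrier Q.I_notcarr by blast
    qed
    fix x y assume carr: "x \<in> carrier (R Quot I)" "y \<in> carrier (R Quot I)"
      and xy: "x \<otimes>\<^bsub>R Quot I\<^esub> y \<in> (+>) I ` Q"
    obtain a b where ab: "a \<in> carrier R" "b \<in> carrier R" "x = I +> a" "y = I +> b"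
      using rep[OF carr(1)] rep[OF carr(2)] by blast
    have "x \<otimes>\<^bsub>R Quot I\<^esub> y = I +> (a \<otimes> b)"
      using ideal.rcoset_mult_add[OF I ab(1,2)] by (simp add: FactRing_def ab(3,4))
    then have "a \<otimes> b \<in> Q" using xy iff[of "a \<otimes> b"] ab(1,2) by (metis m_closed)
    then show "x \<in> (+>) I ` Q \<or> y \<in> (+>) I ` Q"
      using Q.I_prime ab by blast
  qed
qed

text \<open>Union and image are inverse bijections between the ideals of the quotient and the ideals
  above \<open>I\<close>. They preserve primes and, being injective and monotone, strict inclusions,
  so chains can be studied without cosets.\<close>

lemma (in cring) krull_dim_quotient:
  assumes I: "ideal I R"
  shows "krull_dim (R Quot I) = Sup {enat n | n. \<exists>Q :: nat \<Rightarrow> 'a set.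
    (\<forall>i\<le>n. primeideal (Q i) R \<and> I \<subseteq> Q i) \<and> (\<forall>i<n. Q i \<subset> Q (Suc i))}"
proof -
  let ?B = "{J. ideal J R \<and> I \<subseteq> J}" and ?C = "{J. ideal J (R Quot I)}"
  have bij: "bij_betw (\<lambda>J. (+>) I ` J) ?B ?C" by (rule quot_ideal_correspondence[OF I])
  have Un: "\<Union> ((+>) I ` J) = J" if "J \<in> ?B" for J
    using ideal_incl_iff[OF I, of J] that by blast
  have Un': "\<Union> J \<in> ?B \<and> (+>) I ` (\<Union> J) = J" if "J \<in> ?C" for J
    using bij_betw_imp_surj_on[OF bij] that Un by (metis (no_types, lifting) image_iff)
  have "(\<exists>P. (\<forall>i\<le>n. primeideal (P i) (R Quot I)) \<and> (\<forall>i<n. P i \<subset> P (Suc i))) \<longleftrightarrow>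
    (\<exists>Q. (\<forall>i\<le>n. primeideal (Q i) R \<and> I \<subseteq> Q i) \<and> (\<forall>i<n. Q i \<subset> Q (Suc i)))"
    (is "?l = ?r") for n
  proof
    assume ?l
    then obtain P where P: "\<forall>i\<le>n. primeideal (P i) (R Quot I)" "\<forall>i<n. P i \<subset> P (Suc i)" by blast
    have PC: "P i \<in> ?C" if "i \<le> n" for i using P(1) that primeideal.axioms(1) by blast
    show ?r
    proof (intro exI conjI allI impI)
      fix i assume "i \<le> n"
      then show "primeideal (\<Union> (P i)) R" using P primeideal_Union_quotient[OF I] by blast
      show "I \<subseteq> \<Union> (P i)" using Un'[OF PC] \<open>i \<le> n\<close> by blast
    next
      fix i assume "i < n"
      then have "\<Union> (P i) \<noteq> \<Union> (P (Suc i))"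
        using Un'[OF PC[of i]] Un'[OF PC[of "Suc i"]] P(2) by (metis Suc_leI less_imp_le psubset_eq)
      moreover have "\<Union> (P i) \<subseteq> \<Union> (P (Suc i))" using P(2) \<open>i < n\<close> by blast
      ultimately show "\<Union> (P i) \<subset> \<Union> (P (Suc i))" by blast
    qed
  next
    assume ?r
    then obtain Q where Q: "\<forall>i\<le>n. primeideal (Q i) R \<and> I \<subseteq> Q i" "\<forall>i<n. Q i \<subset> Q (Suc i)" by blast
    have QB: "Q i \<in> ?B" if "i \<le> n" for i using Q(1) that primeideal.axioms(1) by blast
    show ?l
    proof (intro exI conjI allI impI)
      fix i assume "i \<le> n"
      then show "primeideal ((+>) I ` Q i) (R Quot I)" using Q primeideal_image_quotient[OF I] by blast
    next
      fix i assume "i < n"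
      then have "(+>) I ` Q i \<noteq> (+>) I ` Q (Suc i)"
        using Un[OF QB[of i]] Un[OF QB[of "Suc i"]] Q(2) by (metis Suc_leI less_imp_le psubset_eq)
      moreover have "(+>) I ` Q i \<subseteq> (+>) I ` Q (Suc i)" using Q(2) \<open>i < n\<close> by blast
      ultimately show "(+>) I ` Q i \<subset> (+>) I ` Q (Suc i)" by blast
    qed
  qed
  then show ?thesis unfolding krull_dim_def by simp
qed

section \<open>The polynomial ring as a type-class ring\<close>

text \<open>Trades the record operations for type-class ones, so that later computations run in
  ordinary ring arithmetic.\<close>

lemma mpoly_ring_simps [simp]:
  "carrier mpoly_ring = UNIV"
  "p \<otimes>\<^bsub>mpoly_ring\<^esub> q = p * q"
  "p \<oplus>\<^bsub>mpoly_ring\<^esub> q = p + q"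
  "\<one>\<^bsub>mpoly_ring\<^esub> = 1"
  "\<zero>\<^bsub>mpoly_ring\<^esub> = 0"
  by (simp_all add: mpoly_ring_def ring_of_type_algebra_def)

lemma cring_mpoly_ring: "cring (mpoly_ring :: ('v::finite, 'k::field) mpoly ring)"
  unfolding mpoly_ring_def by (rule cring_from_type_algebra)

lemma ring_mpoly_ring: "ring (mpoly_ring :: ('v::finite, 'k::field) mpoly ring)"
  by (rule cring.axioms(1)[OF cring_mpoly_ring])

lemma mpoly_ring_pow [simp]: "p [^]\<^bsub>mpoly_ring\<^esub> (n::nat) = p ^ n"
  for p :: "('v::finite, 'k::field) mpoly"
proof -
  interpret cring "mpoly_ring :: ('v, 'k) mpoly ring" by (rule cring_mpoly_ring)
  show ?thesis by (induction n) (simp_all add: mult.commute)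
qed

section \<open>Ideals and prime ideals of the polynomial ring\<close>

lemma ideal_mpoly_ringI:
  fixes J :: "('v::finite, 'k::field) mpoly set"
  assumes "0 \<in> J" "\<And>p q. p \<in> J \<Longrightarrow> q \<in> J \<Longrightarrow> p + q \<in> J" "\<And>p q. q \<in> J \<Longrightarrow> p * q \<in> J"
  shows "ideal J mpoly_ring"
proof -
  interpret cring "mpoly_ring :: ('v, 'k) mpoly ring" by (rule cring_mpoly_ring)
  have inv: "\<ominus>\<^bsub>mpoly_ring\<^esub> p = - p" for p :: "('v, 'k) mpoly"
    by (rule minus_equality) simp_all
  show ?thesis
  proof (rule idealI[OF ring_mpoly_ring], rule add.subgroupI)
    show "\<ominus>\<^bsub>mpoly_ring\<^esub> p \<in> J" if "p \<in> J" for p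
      using assms(3)[OF that, of "-1"] by (simp add: inv)
  qed (use assms in \<open>auto simp: mult.commute\<close>)
qed

context
  fixes J :: "('v::finite, 'k::field) mpoly set"
  assumes J: "ideal J mpoly_ring"
begin

lemma mpoly_ideal_zero: "0 \<in> J"
  using additive_subgroup.zero_closed[OF ideal.axioms(1)[OF J]] by simp

lemma mpoly_ideal_add: "p \<in> J \<Longrightarrow> q \<in> J \<Longrightarrow> p + q \<in> J"
  using additive_subgroup.a_closed[OF ideal.axioms(1)[OF J]] by simp

lemma mpoly_ideal_mult: "q \<in> J \<Longrightarrow> p * q \<in> J"
  using ideal.I_l_closed[OF J] by simp

lemma mpoly_ideal_mult_right: "q \<in> J \<Longrightarrow> q * p \<in> J"
  using ideal.I_r_closed[OF J] by simp

lemma mpoly_ideal_uminus: "p \<in> J \<Longrightarrow> - p \<in> J"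
  using mpoly_ideal_mult[of p "-1"] by simp

lemma mpoly_ideal_diff: "p \<in> J \<Longrightarrow> q \<in> J \<Longrightarrow> p - q \<in> J"
  using mpoly_ideal_add[of p "- q"] mpoly_ideal_uminus[of q] by simp

lemma mpoly_ideal_sum: "(\<And>x. x \<in> A \<Longrightarrow> g x \<in> J) \<Longrightarrow> sum g A \<in> J"
  by (induction A rule: infinite_finite_induct) (auto simp: mpoly_ideal_zero mpoly_ideal_add)

lemma mpoly_ideal_power: "p \<in> J \<Longrightarrow> n > 0 \<Longrightarrow> p ^ n \<in> J"
  by (cases n) (auto simp: mpoly_ideal_mult_right)

end

lemma primeideal_mpoly_ringI:
  fixes J :: "('v::finite, 'k::field) mpoly set"
  assumes "ideal J mpoly_ring" "1 \<notin> J" "\<And>p q. p * q \<in> J \<Longrightarrow> p \<in> J \<or> q \<in> J"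
  shows "primeideal J mpoly_ring"
  by (rule primeidealI[OF assms(1) cring_mpoly_ring]) (use assms in auto)

context
  fixes J :: "('v::finite, 'k::field) mpoly set"
  assumes J: "primeideal J mpoly_ring"
begin

lemma mpoly_prime_ideal: "ideal J mpoly_ring"
  by (rule primeideal.axioms(1)[OF J])

lemma mpoly_prime_mult: "p * q \<in> J \<Longrightarrow> p \<in> J \<or> q \<in> J"
  using primeideal.I_prime[OF J, of p q] by simp

lemma mpoly_prime_one: "1 \<notin> J"
  using primeideal.I_notcarr[OF J] ideal.one_imp_carrier[OF mpoly_prime_ideal] by auto

text \<open>For \<open>n = 0\<close> the premise contradicts properness of \<open>J\<close>;
  otherwise primality splits off one factor at a time.\<close>

lemma mpoly_prime_power: "p ^ n \<in> J \<Longrightarrow> p \<in> J"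
  by (induction n) (auto simp: mpoly_prime_one dest: mpoly_prime_mult)

end

lemma ideal_Idl: "ideal (Idl\<^bsub>mpoly_ring\<^esub> B) (mpoly_ring :: ('v::finite, 'k::field) mpoly ring)"
  by (rule ring.genideal_ideal[OF ring_mpoly_ring]) simp

lemma subset_Idl: "B \<subseteq> Idl\<^bsub>mpoly_ring\<^esub> B" for B :: "('v::finite, 'k::field) mpoly set"
  by (rule ring.genideal_self[OF ring_mpoly_ring]) simp

lemma Idl_subset_iff:
  fixes J :: "('v::finite, 'k::field) mpoly set"
  assumes "ideal J mpoly_ring"
  shows "Idl\<^bsub>mpoly_ring\<^esub> B \<subseteq> J \<longleftrightarrow> B \<subseteq> J"
  using ring.genideal_minimal[OF ring_mpoly_ring assms] subset_Idl[of B] by blast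

lemma radical_mpoly_ring: "p \<in> radical mpoly_ring J \<longleftrightarrow> (\<exists>n. p ^ n \<in> J)"
  for J :: "('v::finite, 'k::field) mpoly set"
  by (simp add: radical_def)

lemma edge_ideal_ideal: "ideal (edge_ideal E :: ('v::finite, 'k::field) mpoly set) mpoly_ring"
  unfolding edge_ideal_def by (rule ideal_Idl)

lemma edge_in_edge_ideal:
  "{u, v} \<in> E \<Longrightarrow> Var u * Var v \<in> (edge_ideal E :: ('v::finite, 'k::field) mpoly set)"
  unfolding edge_ideal_def by (rule subsetD[OF subset_Idl]) auto

lemma edge_ideal_subset_iff:
  fixes J :: "('v::finite, 'k::field) mpoly set"
  assumes "ideal J mpoly_ring"
  shows "edge_ideal E \<subseteq> J \<longleftrightarrow> (\<forall>u v. {u, v} \<in> E \<longrightarrow> Var u * Var v \<in> J)"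
  unfolding edge_ideal_def Idl_subset_iff[OF assms] by (simp add: subset_eq) metis

section \<open>Monomials and evaluation\<close>

lemma poly_mapping_sum_single: "p = (\<Sum>m\<in>Poly_Mapping.keys p. Poly_Mapping.single m (Poly_Mapping.lookup p m))"
  by (rule poly_mapping_eqI)
    (auto simp: lookup_sum lookup_single when_def in_keys_iff)

lemma Const_simps [simp]:
  "Const 0 = 0" "Const 1 = 1" "Const (a + b) = Const a + Const b" "Const (a * b) = Const a * Const b"
  by (simp_all add: Const_def single_add mult_single)

lemma lookup_Const_mult: "Poly_Mapping.lookup (Const a * p) m = a * Poly_Mapping.lookup p m"
  unfolding Const_def mult_map_scale_conv_mult[symmetric]
  by (simp add: Poly_Mapping.map.rep_eq when_def)

text \<open>The coefficient map \<open>h\<close> allows values in other rings: \<open>id\<close>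
  gives points over \<open>'k\<close>, and the embedding of \<open>'k\<close> into
  \<open>'k poly poly\<close> lets variables go to indeterminates.\<close>

definition eval_mpoly :: "('k \<Rightarrow> 'a::comm_ring_1) \<Rightarrow> ('v \<Rightarrow> 'a) \<Rightarrow> ('v::finite, 'k::field) mpoly \<Rightarrow> 'a" where
  "eval_mpoly h g p =
    (\<Sum>m\<in>Poly_Mapping.keys p. h (Poly_Mapping.lookup p m) * (\<Prod>v\<in>UNIV. g v ^ Poly_Mapping.lookup m v))"

context
  fixes h :: "'k::field \<Rightarrow> 'a::comm_ring_1" and g :: "'v::finite \<Rightarrow> 'a"
  assumes h_add: "\<And>a b. h (a + b) = h a + h b" and h_mult: "\<And>a b. h (a * b) = h a * h b"
    and h_one: "h 1 = 1"
begin

private lemma h_zero: "h 0 = 0"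
  using h_add[of 0 0] by simp

lemma eval_mpoly_single:
  "eval_mpoly h g (Poly_Mapping.single m a) = h a * (\<Prod>v\<in>UNIV. g v ^ Poly_Mapping.lookup m v)"
  by (simp add: eval_mpoly_def h_zero)

lemma eval_mpoly_zero: "eval_mpoly h g 0 = 0"
  by (simp add: eval_mpoly_def)

lemma eval_mpoly_Const: "eval_mpoly h g (Const a) = h a"
  by (simp add: Const_def eval_mpoly_single)

lemma eval_mpoly_one: "eval_mpoly h g 1 = 1"
  using eval_mpoly_Const[of 1] by (simp add: h_one)

lemma eval_mpoly_Var: "eval_mpoly h g (Var u) = g u"
proof -
  have "(\<Prod>v\<in>UNIV. g v ^ (1 when u = v)) = (\<Prod>v\<in>UNIV. if u = v then g v else 1)"
    by (intro prod.cong) (auto simp: when_def)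
  then show ?thesis
    by (simp add: Var_def eval_mpoly_single lookup_single h_one)
qed

lemma eval_mpoly_add: "eval_mpoly h g (p + q) = eval_mpoly h g p + eval_mpoly h g q"
  unfolding eval_mpoly_def
  by (rule setsum_keys_plus_distrib) (simp_all add: h_zero h_add distrib_right)

lemma eval_mpoly_sum: "eval_mpoly h g (sum f A) = (\<Sum>x\<in>A. eval_mpoly h g (f x))"
  by (induction A rule: infinite_finite_induct) (simp_all add: eval_mpoly_add eval_mpoly_zero)

lemma eval_mpoly_mult: "eval_mpoly h g (p * q) = eval_mpoly h g p * eval_mpoly h g q"
proof -
  \<comment> \<open>Both factors are expanded into terms first, because different pairs
    \<open>m\<close>, \<open>n\<close> can contribute to the same monomial of
    \<open>p * q\<close>.\<close>
  have "p * q = (\<Sum>m\<in>Poly_Mapping.keys p. \<Sum>n\<in>Poly_Mapping.keys q.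
      Poly_Mapping.single (m + n) (Poly_Mapping.lookup p m * Poly_Mapping.lookup q n))"
    by (subst poly_mapping_sum_single[of p], subst poly_mapping_sum_single[of q])
      (simp add: sum_product mult_single)
  then show ?thesis
    by (simp add: eval_mpoly_sum eval_mpoly_single lookup_add power_add prod.distrib h_mult
        eval_mpoly_def[of h g p] eval_mpoly_def[of h g q] sum_product mult_ac)
qed

lemma eval_mpoly_power: "eval_mpoly h g (p ^ n) = eval_mpoly h g p ^ n"
  by (induction n) (simp_all add: eval_mpoly_mult eval_mpoly_one)

end

lemma lookup_Var: "Poly_Mapping.lookup (Var v :: ('v::finite, 'k::field) mpoly) m = (if m = Poly_Mapping.single v 1 then 1 else 0)"
  by (auto simp: Var_def lookup_single when_def)

section \<open>The irrelevant ideal and radicals\<close>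

lemma mpoly_in_idealI:
  fixes J :: "('v::finite, 'k::field) mpoly set"
  assumes J: "ideal J mpoly_ring"
    and keys: "\<And>m. m \<in> Poly_Mapping.keys p \<Longrightarrow> \<exists>v. Var v \<in> J \<and> Poly_Mapping.lookup m v > 0"
  shows "p \<in> J"
proof -
  have "Poly_Mapping.single m (Poly_Mapping.lookup p m) \<in> J" if m: "m \<in> Poly_Mapping.keys p" for m
  proof -
    obtain v where v: "Var v \<in> J" "Poly_Mapping.lookup m v > 0"
      using keys[OF m] by blast
    \<comment> \<open>Subtraction of exponents is truncated; the positive exponent of
      \<open>v\<close> makes this an exact division by \<open>Var v\<close>.\<close>
    have "(m - Poly_Mapping.single v 1) + Poly_Mapping.single v 1 = m"
      using v(2) by (intro poly_mapping_eqI) (auto simp: lookup_add lookup_minus lookup_single when_def)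
    then have "Poly_Mapping.single m (Poly_Mapping.lookup p m) =
        Poly_Mapping.single (m - Poly_Mapping.single v 1) (Poly_Mapping.lookup p m) * Var v"
      by (simp add: Var_def mult_single)
    then show ?thesis using mpoly_ideal_mult[OF J v(1)] by simp
  qed
  then show ?thesis
    by (subst poly_mapping_sum_single) (rule mpoly_ideal_sum[OF J])
qed

text \<open>Evaluation at the origin returns the constant term, since \<open>0 ^ 0 = 1\<close>; a
  polynomial without constant term has a variable in each of its monomials.\<close>

lemma irrelevant_ideal_iff:
  fixes p :: "('v::finite, 'k::field) mpoly"
  shows "p \<in> irrelevant_ideal \<longleftrightarrow> eval_mpoly id (\<lambda>_. 0) p = 0"
proof
  let ?ev = "eval_mpoly id (\<lambda>_. 0) :: ('v, 'k) mpoly \<Rightarrow> 'k"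
  have "ideal {p. ?ev p = 0} mpoly_ring"
    by (rule ideal_mpoly_ringI) (simp_all add: eval_mpoly_zero eval_mpoly_add eval_mpoly_mult)
  then have "irrelevant_ideal \<subseteq> {p. ?ev p = 0}"
    unfolding irrelevant_ideal_def by (subst Idl_subset_iff) (auto simp: eval_mpoly_Var)
  then show "p \<in> irrelevant_ideal \<Longrightarrow> ?ev p = 0" by blast
  assume ev: "?ev p = 0"
  have "(\<Prod>v\<in>UNIV. (0::'k) ^ Poly_Mapping.lookup m v) = (if m = 0 then 1 else 0)"
    for m :: "'v \<Rightarrow>\<^sub>0 nat"
    by (auto simp: poly_mapping_eq_iff fun_eq_iff)
  then have "?ev p = (\<Sum>m\<in>Poly_Mapping.keys p. if m = 0 then Poly_Mapping.lookup p m else 0)"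
    unfolding eval_mpoly_def by (intro sum.cong) auto
  with ev have zero: "0 \<notin> Poly_Mapping.keys p"
    by (auto simp: in_keys_iff split: if_splits)
  have "\<exists>v. Poly_Mapping.lookup m v > 0" if "m \<in> Poly_Mapping.keys p" for m
  proof (rule ccontr)
    assume "\<nexists>v. Poly_Mapping.lookup m v > 0"
    then have "m = 0" by (intro poly_mapping_eqI) simp
    with that zero show False by simp
  qed
  then show "p \<in> irrelevant_ideal"
    unfolding irrelevant_ideal_def
    by (intro mpoly_in_idealI[OF ideal_Idl]) (use subset_Idl in blast)
qed

lemma Var_in_irrelevant_ideal: "Var v \<in> (irrelevant_ideal :: ('v::finite, 'k::field) mpoly set)"
  by (simp add: irrelevant_ideal_iff eval_mpoly_Var)

lemma irrelevant_ideal_ideal: "ideal irrelevant_ideal (mpoly_ring :: ('v::finite, 'k::field) mpoly ring)"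
  unfolding irrelevant_ideal_def by (rule ideal_Idl)

text \<open>If a power of \<open>p\<close> vanishes at the origin, so does \<open>p\<close>, because
  its value lies in a field.\<close>

lemma radical_subset_irrelevant_ideal:
  fixes J :: "('v::finite, 'k::field) mpoly set"
  assumes "J \<subseteq> irrelevant_ideal"
  shows "radical mpoly_ring J \<subseteq> irrelevant_ideal"
proof
  fix p assume "p \<in> radical mpoly_ring J"
  then obtain n where "p ^ n \<in> irrelevant_ideal"
    using assms by (auto simp: radical_mpoly_ring)
  then have "eval_mpoly id (\<lambda>_. 0) p ^ n = 0"
    by (simp add: irrelevant_ideal_iff eval_mpoly_power)
  then show "p \<in> irrelevant_ideal" by (simp add: irrelevant_ideal_iff)
qed

lemma ideal_radical:
  fixes J :: "('v::finite, 'k::field) mpoly set"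
  assumes J: "ideal J mpoly_ring"
  shows "ideal (radical mpoly_ring J) mpoly_ring"
proof (rule ideal_mpoly_ringI)
  have "0 ^ 1 \<in> J" using mpoly_ideal_zero[OF J] by simp
  then show "0 \<in> radical mpoly_ring J" unfolding radical_mpoly_ring by blast
next
  fix p q assume "q \<in> radical mpoly_ring J"
  then obtain n where "q ^ n \<in> J" by (auto simp: radical_mpoly_ring)
  then have "(p * q) ^ n \<in> J" by (simp add: power_mult_distrib mpoly_ideal_mult[OF J])
  then show "p * q \<in> radical mpoly_ring J" by (auto simp: radical_mpoly_ring)
next
  fix p q assume "p \<in> radical mpoly_ring J" "q \<in> radical mpoly_ring J"
  then obtain a b where ab: "p ^ a \<in> J" "q ^ b \<in> J" by (auto simp: radical_mpoly_ring)
  \<comment> \<open>In each term of the binomial expansion of \<open>(p + q) ^ (a + b)\<close>,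
    either \<open>p\<close> has exponent at least \<open>a\<close> or \<open>q\<close> has exponent
    at least \<open>b\<close>.\<close>
  have "of_nat (a + b choose k) * p ^ k * q ^ (a + b - k) \<in> J" if "k \<le> a + b" for k
  proof (cases "a \<le> k")
    case True
    then have "p ^ k = p ^ (k - a) * p ^ a" by (simp flip: power_add)
    then have "p ^ k \<in> J" using mpoly_ideal_mult[OF J ab(1)] by simp
    then show ?thesis by (intro mpoly_ideal_mult[OF J] mpoly_ideal_mult_right[OF J])
  next
    case False
    then have "q ^ (a + b - k) = q ^ (a - k) * q ^ b" by (simp flip: power_add)
    then have "q ^ (a + b - k) \<in> J" using mpoly_ideal_mult[OF J ab(2)] by simp
    then show ?thesis by (intro mpoly_ideal_mult[OF J])
  qed
  then have "(p + q) ^ (a + b) \<in> J"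
    unfolding binomial_ring by (intro mpoly_ideal_sum[OF J]) simp
  then show "p + q \<in> radical mpoly_ring J" by (auto simp: radical_mpoly_ring)
qed

section \<open>The Krull dimension of the edge ring\<close>

text \<open>Gaussian elimination, one equation at a time: equation \<open>t\<close> is solved for an
  unknown \<open>y\<close> with nonzero coefficient, which is then eliminated from the other
  equations.\<close>

lemma homogeneous_system_nontrivial:
  fixes c :: "'x \<Rightarrow> 't \<Rightarrow> 'k::field"
  assumes "finite T" "finite A" "card T < card A"
  shows "\<exists>l. (\<exists>x\<in>A. l x \<noteq> 0) \<and> (\<forall>t\<in>T. (\<Sum>x\<in>A. l x * c x t) = 0)"
  using assms
proof (induction T arbitrary: A c rule: finite_induct)
  case empty
  then have "A \<noteq> {}" by auto
  then show ?case by (intro exI[of _ "\<lambda>_. 1"]) auto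
next
  case (insert t T)
  show ?case
  proof (cases "\<exists>y\<in>A. c y t \<noteq> 0")
    case False
    obtain l where "\<exists>x\<in>A. l x \<noteq> 0" "\<forall>s\<in>T. (\<Sum>x\<in>A. l x * c x s) = 0"
      using insert.IH[of A c] insert.prems insert.hyps by auto
    with False show ?thesis by (intro exI[of _ l]) auto
  next
    case True
    then obtain y where y: "y \<in> A" "c y t \<noteq> 0" by blast
    define r where "r x = c x t / c y t" for x
    obtain l where l: "\<exists>x\<in>A - {y}. l x \<noteq> 0"
      "\<forall>s\<in>T. (\<Sum>x\<in>A - {y}. l x * (c x s - r x * c y s)) = 0"
      using insert.IH[of "A - {y}" "\<lambda>x s. c x s - r x * c y s"] insert.prems insert.hyps y(1)
      by (auto simp: less_diff_conv)
    \<comment> \<open>Back substitution: the value at \<open>y\<close> is the one that equation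
      \<open>t\<close> forces.\<close>
    define l' where "l' = l(y := - (\<Sum>x\<in>A - {y}. l x * r x))"
    have eq: "(\<Sum>x\<in>A. l' x * c x s) = (\<Sum>x\<in>A - {y}. l x * (c x s - r x * c y s))" for s
    proof -
      have "(\<Sum>x\<in>A. l' x * c x s) = l' y * c y s + (\<Sum>x\<in>A - {y}. l' x * c x s)"
        using y insert.prems by (intro sum.remove) auto
      also have "(\<Sum>x\<in>A - {y}. l' x * c x s) = (\<Sum>x\<in>A - {y}. l x * c x s)"
        by (intro sum.cong) (auto simp: l'_def)
      also have "l' y * c y s + \<dots> = (\<Sum>x\<in>A - {y}. l x * (c x s - r x * c y s))"
        by (simp add: l'_def sum_distrib_left algebra_simps sum_subtractf)
      finally show ?thesis .
    qed
    have "(\<Sum>x\<in>A. l' x * c x t) = 0"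
      unfolding eq using y by (simp add: r_def)
    moreover have "\<forall>s\<in>T. (\<Sum>x\<in>A. l' x * c x s) = 0" using l(2) by (simp add: eq)
    moreover have "\<exists>x\<in>A. l' x \<noteq> 0" using l(1) by (auto simp: l'_def)
    ultimately show ?thesis by blast
  qed
qed

text \<open>Each exponent is bounded separately, instead of the total degree, so that the monomials
  within the bound form a box that is easy to count.\<close>

definition exps_le :: "nat \<Rightarrow> ('v::finite, 'k::field) mpoly \<Rightarrow> bool" where
  "exps_le d p \<longleftrightarrow> (\<forall>m\<in>Poly_Mapping.keys p. \<forall>v. Poly_Mapping.lookup m v \<le> d)"

lemma exps_le_mult: "exps_le d p \<Longrightarrow> exps_le e q \<Longrightarrow> exps_le (d + e) (p * q)"
  unfolding exps_le_def using keys_mult[of p q] by (fastforce simp: lookup_add intro: add_mono)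

lemma exps_le_power: "exps_le d p \<Longrightarrow> exps_le (n * d) (p ^ n)"
  by (induction n) (auto simp: exps_le_def[of 0] exps_le_mult)

lemma exps_le_mono: "exps_le d p \<Longrightarrow> d \<le> e \<Longrightarrow> exps_le e p"
  unfolding exps_le_def using le_trans by blast

lemma exps_le_ex: "\<exists>d. exps_le d p" for p :: "('v::finite, 'k::field) mpoly"
proof -
  let ?N = "(\<lambda>(m, v). Poly_Mapping.lookup m v) ` (Poly_Mapping.keys p \<times> (UNIV :: 'v set))"
  have "exps_le (Max ?N) p" unfolding exps_le_def by (auto intro!: Max_ge)
  then show ?thesis by blast
qed

text \<open>The \<open>N\<^sup>3\<close> products \<open>a\<^sup>i b\<^sup>j c\<^sup>k\<close> with \<open>i, j, k < N\<close> have, modulo the variables outside \<open>A\<close>,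
  only \<open>O(N\<^sup>2)\<close> monomials, so they are linearly dependent for large \<open>N\<close>.\<close>

lemma three_mpolys_dependent:
  fixes J :: "('v::finite, 'k::field) mpoly set"
  assumes J: "ideal J mpoly_ring" and A: "card A \<le> 2" "\<And>v. v \<notin> A \<Longrightarrow> Var v \<in> J"
  shows "\<exists>F l. finite F \<and> F \<noteq> {} \<and> (\<forall>x\<in>F. l x \<noteq> 0) \<and>
    (\<Sum>(i, j, k)\<in>F. Const (l (i, j, k)) * a ^ i * b ^ j * c ^ k) \<in> J"
proof -
  obtain da db dc where d: "exps_le da a" "exps_le db b" "exps_le dc c"
    using exps_le_ex by metis
  \<comment> \<open>The summand 1 ensures \<open>D \<ge> 1\<close>, which gives
    \<open>M + 1 \<le> 4 * N * D\<close> below.\<close>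
  define D where "D = da + db + dc + 1"
  have D: "exps_le D a" "exps_le D b" "exps_le D c" "D \<ge> 1"
    using d by (auto simp: D_def intro: exps_le_mono)
  \<comment> \<open>Chosen to exceed \<open>16 * D\<^sup>2\<close>, so that the at most
    \<open>(4 * N * D)\<^sup>2\<close> monomials are fewer than the \<open>N * N * N\<close>
    products.\<close>
  define N where "N = 16 * D\<^sup>2 + 1"
  define B where "B = {..<N} \<times> {..<N} \<times> {..<N}"
  define M where "M = 3 * N * D"
  define T where "T = {m :: 'v \<Rightarrow>\<^sub>0 nat. (\<forall>v. Poly_Mapping.lookup m v \<le> M) \<and> (\<forall>v. v \<notin> A \<longrightarrow> Poly_Mapping.lookup m v = 0)}"
  \<comment> \<open>A monomial in \<open>T\<close> is determined by its exponents on
    \<open>A\<close>, so \<open>T\<close> has at most \<open>(M + 1) ^ card A\<close>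
    elements.\<close>
  have inj: "inj_on (\<lambda>m. restrict (Poly_Mapping.lookup m) A) T"
  proof (rule inj_onI)
    fix m n assume *: "m \<in> T" "n \<in> T" "restrict (Poly_Mapping.lookup m) A = restrict (Poly_Mapping.lookup n) A"
    have "Poly_Mapping.lookup m v = Poly_Mapping.lookup n v" for v
    proof (cases "v \<in> A")
      case True
      then show ?thesis using fun_cong[OF *(3), of v] unfolding restrict_apply by (simp only: if_True)
    qed (use *(1,2) in \<open>auto simp: T_def\<close>)
    then show "m = n" by (rule poly_mapping_eqI)
  qed
  have img: "(\<lambda>m. restrict (Poly_Mapping.lookup m) A) ` T \<subseteq> A \<rightarrow>\<^sub>E {..M}"
    by (auto simp: T_def)
  have fin: "finite (A \<rightarrow>\<^sub>E {..M})" by (intro finite_PiE) auto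
  have finT: "finite T" using inj_on_finite[OF inj img fin] .
  have "N * D \<ge> 1" using D(4) by (simp add: N_def)
  then have square: "(M + 1) ^ 2 \<le> (4 * N * D) ^ 2" by (intro power_mono) (auto simp: M_def)
  have "card T \<le> card (A \<rightarrow>\<^sub>E {..M})" using card_inj_on_le[OF inj img fin] .
  also have "\<dots> = (M + 1) ^ card A" by (simp add: card_PiE)
  also have "\<dots> \<le> (M + 1) ^ 2" using A(1) by (intro power_increasing) auto
  also note square
  also have "(4 * N * D) ^ 2 = 16 * D\<^sup>2 * (N * N)" by (simp add: power2_eq_square)
  also have "\<dots> < N * (N * N)" by (intro mult_strict_right_mono) (auto simp: N_def)
  also have "\<dots> = card B" by (simp add: B_def card_cartesian_product)
  finally have card: "card T < card B" .
  define f where "f = (\<lambda>(i, j, k). a ^ i * b ^ j * c ^ k)"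
  have f: "exps_le M (f x)" if "x \<in> B" for x
  proof -
    obtain i j k where x: "x = (i, j, k)" by (cases x)
    have "exps_le (i * D + j * D + k * D) (f x)"
      unfolding x f_def using D by (auto intro!: exps_le_mult exps_le_power)
    moreover have "i * D + j * D + k * D \<le> M"
    proof -
      have "i * D \<le> N * D" "j * D \<le> N * D" "k * D \<le> N * D"
        using that by (auto simp: x B_def intro!: mult_le_mono)
      moreover have "M = N * D + N * D + N * D" by (simp add: M_def)
      ultimately show ?thesis by linarith
    qed
    ultimately show ?thesis by (rule exps_le_mono)
  qed
  \<comment> \<open>One equation for each monomial in \<open>T\<close>, one unknown for each
    product: the combination \<open>r\<close> has no monomial in \<open>T\<close>. Its exponents are
    at most \<open>M\<close>, so every monomial that remains contains a variable outside
    \<open>A\<close>.\<close>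
  obtain l where l: "\<exists>x\<in>B. l x \<noteq> 0" "\<forall>m\<in>T. (\<Sum>x\<in>B. l x * Poly_Mapping.lookup (f x) m) = 0"
    using homogeneous_system_nontrivial[OF finT _ card, of "\<lambda>x. Poly_Mapping.lookup (f x)"]
    by (auto simp: B_def)
  define F where "F = {x \<in> B. l x \<noteq> 0}"
  have finF: "finite B" "finite F" by (auto simp: B_def F_def)
  define r where "r = (\<Sum>x\<in>B. Const (l x) * f x)"
  have lr: "Poly_Mapping.lookup r m = (\<Sum>x\<in>B. l x * Poly_Mapping.lookup (f x) m)" for m
    by (simp add: r_def lookup_sum lookup_Const_mult)
  have "r \<in> J"
  proof (rule mpoly_in_idealI[OF J])
    fix m assume m: "m \<in> Poly_Mapping.keys r"
    then have "(\<Sum>x\<in>B. l x * Poly_Mapping.lookup (f x) m) \<noteq> 0" by (simp add: in_keys_iff lr)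
    then obtain x where "x \<in> B" "l x * Poly_Mapping.lookup (f x) m \<noteq> 0"
      by (rule sum.not_neutral_contains_not_neutral)
    then have bound: "\<forall>v. Poly_Mapping.lookup m v \<le> M"
      using f[of x] by (auto simp: exps_le_def in_keys_iff)
    have "m \<notin> T" using l(2) m by (auto simp: in_keys_iff lr)
    with bound obtain v where "v \<notin> A" "Poly_Mapping.lookup m v \<noteq> 0" by (auto simp: T_def)
    then show "\<exists>v. Var v \<in> J \<and> Poly_Mapping.lookup m v > 0" using A(2)[of v] by auto
  qed
  moreover have "r = (\<Sum>x\<in>F. Const (l x) * f x)"
    unfolding r_def F_def using finF by (intro sum.mono_neutral_right) auto
  moreover have "\<dots> = (\<Sum>(i, j, k)\<in>F. Const (l (i, j, k)) * a ^ i * b ^ j * c ^ k)"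
    by (intro sum.cong) (auto simp: f_def mult.assoc)
  ultimately have "(\<Sum>(i, j, k)\<in>F. Const (l (i, j, k)) * a ^ i * b ^ j * c ^ k) \<in> J" by simp
  moreover have "F \<noteq> {}" "\<forall>x\<in>F. l x \<noteq> 0" using l(1) by (auto simp: F_def)
  ultimately show ?thesis using finF(2) by (intro exI[of _ F] exI[of _ l]) simp
qed

text \<open>Cancel the lowest power of \<open>a\<close> modulo \<open>P\<close>, then reduce modulo \<open>a\<close>.\<close>

lemma lowest_coefficient_in_ideal:
  fixes P Q :: "('v::finite, 'k::field) mpoly set"
  assumes P: "primeideal P mpoly_ring" and Q: "ideal Q mpoly_ring" and "P \<subseteq> Q"
    and a: "a \<in> Q" "a \<notin> P" and F: "finite F" and s: "(\<Sum>x\<in>F. f x * a ^ e x) \<in> P"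
  shows "(\<Sum>x\<in>{x\<in>F. e x = Min (e ` F)}. f x) \<in> Q"
proof -
  define n where "n = Min (e ` F)"
  have n: "n \<le> e x" if "x \<in> F" for x using that F by (simp add: n_def)
  have "(\<Sum>x\<in>F. f x * a ^ e x) = a ^ n * (\<Sum>x\<in>F. f x * a ^ (e x - n))"
    unfolding sum_distrib_left
  proof (rule sum.cong)
    fix x assume "x \<in> F"
    then have "a ^ e x = a ^ n * a ^ (e x - n)" using n by (simp flip: power_add)
    then show "f x * a ^ e x = a ^ n * (f x * a ^ (e x - n))" by (simp add: mult_ac)
  qed simp
  then have "(\<Sum>x\<in>F. f x * a ^ (e x - n)) \<in> P"
    using s mpoly_prime_mult[OF P] mpoly_prime_power[OF P, of a n] a(2) by auto
  then have "(\<Sum>x\<in>F. f x * a ^ (e x - n)) \<in> Q" using \<open>P \<subseteq> Q\<close> by blast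
  moreover have "(\<Sum>x\<in>F - {x\<in>F. e x = n}. f x * a ^ (e x - n)) \<in> Q"
  proof (rule mpoly_ideal_sum[OF Q])
    fix x assume "x \<in> F - {x\<in>F. e x = n}"
    then have "e x - n > 0" using n[of x] by auto
    then show "f x * a ^ (e x - n) \<in> Q"
      using mpoly_ideal_mult[OF Q mpoly_ideal_power[OF Q a(1)]] by blast
  qed
  ultimately have "(\<Sum>x\<in>F. f x * a ^ (e x - n)) - (\<Sum>x\<in>F - {x\<in>F. e x = n}. f x * a ^ (e x - n)) \<in> Q"
    by (rule mpoly_ideal_diff[OF Q])
  moreover have "(\<Sum>x\<in>F. f x * a ^ (e x - n)) =
      (\<Sum>x\<in>F - {x\<in>F. e x = n}. f x * a ^ (e x - n)) + (\<Sum>x\<in>{x\<in>F. e x = n}. f x * a ^ (e x - n))"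
    using F by (intro sum.subset_diff) auto
  ultimately show ?thesis by (simp add: n_def)
qed

text \<open>Each step up the chain removes one of \<open>a 0\<close>, \<open>a 1\<close>,
  \<open>a 2\<close> from the dependence, keeping only the terms with its least exponent. After
  three steps a single nonzero constant is left in \<open>P 3\<close>.\<close>

lemma no_chain_of_four_primes:
  fixes P :: "nat \<Rightarrow> ('v::finite, 'k::field) mpoly set"
  assumes P: "\<And>i. i \<le> 3 \<Longrightarrow> primeideal (P i) mpoly_ring" and chain: "\<And>i. i < 3 \<Longrightarrow> P i \<subset> P (Suc i)"
    and A: "card A \<le> 2" "\<And>v. v \<notin> A \<Longrightarrow> Var v \<in> P 0"
  shows False
proof -
  have id: "ideal (P i) mpoly_ring" if "i \<le> 3" for i using mpoly_prime_ideal[OF P[OF that]] .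
  have "\<exists>a. a \<in> P (Suc i) \<and> a \<notin> P i" if "i < 3" for i using chain[OF that] by blast
  then obtain a where a: "\<And>i. i < 3 \<Longrightarrow> a i \<in> P (Suc i)" "\<And>i. i < 3 \<Longrightarrow> a i \<notin> P i" by metis
  obtain F l where F: "finite F" "F \<noteq> {}" "\<forall>x\<in>F. l x \<noteq> 0"
    and rel: "(\<Sum>(i, j, k)\<in>F. Const (l (i, j, k)) * a 0 ^ i * a 1 ^ j * a 2 ^ k) \<in> P 0"
    using three_mpolys_dependent[OF id[of 0] A, of "a 0" "a 1" "a 2"] by auto
  \<comment> \<open>\<open>e n\<close> is the exponent of \<open>a n\<close> in a term; making it
    depend on \<open>n\<close> lets \<open>step\<close> serve all three rounds.\<close>
  define e :: "nat \<Rightarrow> nat \<times> nat \<times> nat \<Rightarrow> nat" where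
    "e n = (\<lambda>(i, j, k). if n = 0 then i else if n = 1 then j else k)" for n
  define low where "low n G = {x\<in>G. e n x = Min (e n ` G)}" for n G
  have low: "low n G \<noteq> {} \<and> finite (low n G) \<and> low n G \<subseteq> G" if "G \<noteq> {}" "finite G" for n G
  proof -
    have "Min (e n ` G) \<in> e n ` G" using that by (intro Min_in) auto
    then obtain x where "x \<in> G" "e n x = Min (e n ` G)" by fastforce
    then have "x \<in> low n G" by (simp add: low_def)
    moreover have "low n G \<subseteq> G" by (auto simp: low_def)
    ultimately show ?thesis using that(2) finite_subset by blast
  qed
  define G1 where "G1 = low 0 F"
  define G2 where "G2 = low 1 G1"
  define G3 where "G3 = low 2 G2"
  have G1: "G1 \<noteq> {}" "finite G1" "G1 \<subseteq> F" using low[of F 0] F by (auto simp: G1_def)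
  have G2: "G2 \<noteq> {}" "finite G2" "G2 \<subseteq> G1" using low[of G1 1] G1 by (auto simp: G2_def)
  have G3: "G3 \<noteq> {}" "finite G3" "G3 \<subseteq> G2" using low[of G2 2] G2 by (auto simp: G3_def)
  have step: "(\<Sum>x\<in>low n G. f x) \<in> P (Suc n)"
    if "n < 3" "finite G" "(\<Sum>x\<in>G. f x * a n ^ e n x) \<in> P n" for n G f
    unfolding low_def
    by (rule lowest_coefficient_in_ideal[of "P n" "P (Suc n)" "a n"])
      (use that P id a chain[OF that(1)] in auto)
  have "(\<Sum>x\<in>F. (Const (l x) * a 1 ^ e 1 x * a 2 ^ e 2 x) * a 0 ^ e 0 x) \<in> P 0"
    using rel by (simp add: e_def split_def mult_ac)
  then have "(\<Sum>x\<in>G1. Const (l x) * a 1 ^ e 1 x * a 2 ^ e 2 x) \<in> P 1"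
    using step[of 0 F] F by (simp add: G1_def)
  then have "(\<Sum>x\<in>G1. (Const (l x) * a 2 ^ e 2 x) * a 1 ^ e 1 x) \<in> P 1"
    by (simp add: mult_ac)
  then have "(\<Sum>x\<in>G2. Const (l x) * a 2 ^ e 2 x) \<in> P 2"
    using step[of 1 G1] G1 by (simp add: G2_def numeral_2_eq_2)
  then have sum: "(\<Sum>x\<in>G3. Const (l x)) \<in> P 3"
    using step[of 2 G2] G2 by (simp add: G3_def numeral_3_eq_3)
  obtain x where x: "x \<in> G3" using G3 by blast
  \<comment> \<open>Surviving terms share the minimal exponent chosen in each round, so all three
    coordinates agree.\<close>
  have "y = x" if "y \<in> G3" for y
  proof -
    have eq: "e n y = e n x" if "y \<in> low n G" "x \<in> low n G" for n G
      using that by (simp add: low_def)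
    have "e 0 y = e 0 x" "e 1 y = e 1 x" "e 2 y = e 2 x"
      using eq[of 0 F] eq[of 1 G1] eq[of 2 G2] x \<open>y \<in> G3\<close> G3(3) G2(3)
      unfolding G1_def[symmetric] G2_def[symmetric] G3_def[symmetric] by blast+
    then show ?thesis by (cases x; cases y) (simp add: e_def)
  qed
  then have "G3 = {x}" using x by blast
  then have "Const (l x) \<in> P 3" using sum by simp
  then have "Const (inverse (l x)) * Const (l x) \<in> P 3" by (intro mpoly_ideal_mult[OF id]) auto
  moreover have "l x \<noteq> 0" using x G3 G2 G1 F by blast
  ultimately have "1 \<in> P 3" by (simp flip: Const_simps)
  then show False using mpoly_prime_one[OF P] by blast
qed

section \<open>Independent sets and the value of the dimension\<close>

text \<open>For an edge the product of its two variables lies in \<open>P\<close>, hence so does one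
  of them. The independence number therefore bounds the number of variables that survive modulo a
  prime.\<close>

lemma indep_variables_outside_prime:
  fixes P :: "('v::finite, 'k::field) mpoly set"
  assumes P: "primeideal P mpoly_ring" and "edge_ideal E \<subseteq> P"
  shows "indep {v. Var v \<notin> P} E"
  using assms mpoly_prime_mult[OF P] edge_in_edge_ideal unfolding indep_def by blast

text \<open>The kernel of a homomorphism into a domain is prime. The second map
  \<open>\<phi>\<close> is kept separate so that one evaluation can be followed by different
  specialisations of the indeterminates.\<close>

lemma primeideal_eval_kernel:
  fixes h :: "'k::field \<Rightarrow> 'a::comm_ring_1" and g :: "'v::finite \<Rightarrow> 'a"
    and \<phi> :: "'a \<Rightarrow> 'b::idom"
  assumes "\<And>a b. h (a + b) = h a + h b" "\<And>a b. h (a * b) = h a * h b" "h 1 = 1"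
    and "\<And>x y. \<phi> (x + y) = \<phi> x + \<phi> y" "\<And>x y. \<phi> (x * y) = \<phi> x * \<phi> y" "\<phi> 1 = 1"
  shows "primeideal {p :: ('v, 'k) mpoly. \<phi> (eval_mpoly h g p) = 0} mpoly_ring"
proof -
  have "\<phi> 0 + \<phi> 0 = \<phi> 0 + 0" using assms(4)[of 0 0] by (simp only: add_0_left add_0_right)
  then have "\<phi> 0 = 0" by (rule add_left_imp_eq)
  then show ?thesis
    by (intro primeideal_mpoly_ringI ideal_mpoly_ringI)
      (simp_all add: assms eval_mpoly_zero eval_mpoly_one eval_mpoly_add eval_mpoly_mult)
qed

lemma independence_number_ge:
  fixes E :: "'v::finite set set"
  assumes "indep A E"
  shows "card A \<le> independence_number E"
  unfolding independence_number_def using assms by (intro Max_ge) auto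

lemma independence_number_attained:
  fixes E :: "'v::finite set set"
  obtains A where "indep A E" "card A = independence_number E"
proof -
  have "independence_number E \<in> {card A | A. indep A E}"
    unfolding independence_number_def by (intro Max_in) (auto intro: exI[of _ "{}"])
  then show thesis using that by auto
qed

text \<open>The chain of length two consists of the kernels of the homomorphisms sending \<open>u\<close>, \<open>v\<close> to two
  indeterminates \<open>s\<close>, \<open>t\<close> and the other variables to \<open>0\<close>, followed by \<open>s = 0\<close> and then \<open>t = 0\<close>.\<close>

lemma krull_dim_edge_ring:
  fixes E :: "'v::finite set set"
  assumes simple: "simple_graph E" and E: "independence_number E = 2"
  shows "krull_dim (mpoly_ring Quot (edge_ideal E :: ('v, 'k::field) mpoly set)) = 2"
proof -
  let ?I = "edge_ideal E :: ('v, 'k) mpoly set"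
  let ?S = "{enat n | n. \<exists>Q :: nat \<Rightarrow> ('v, 'k) mpoly set.
    (\<forall>i\<le>n. primeideal (Q i) mpoly_ring \<and> ?I \<subseteq> Q i) \<and> (\<forall>i<n. Q i \<subset> Q (Suc i))}"
  have dim: "krull_dim (mpoly_ring Quot ?I) = Sup ?S"
    by (rule cring.krull_dim_quotient[OF cring_mpoly_ring edge_ideal_ideal])
  have "Sup ?S \<le> 2"
  proof (rule Sup_least, clarify)
    fix n and Q :: "nat \<Rightarrow> ('v, 'k) mpoly set"
    assume Q: "\<forall>i\<le>n. primeideal (Q i) mpoly_ring \<and> ?I \<subseteq> Q i" "\<forall>i<n. Q i \<subset> Q (Suc i)"
    have "n \<le> 2"
    proof (rule ccontr)
      assume "\<not> n \<le> 2"
      have "card {v. Var v \<notin> Q 0} \<le> 2"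
        using independence_number_ge[OF indep_variables_outside_prime[of "Q 0" E]] Q(1) E by auto
      then show False
      proof (rule no_chain_of_four_primes[rotated 2])
        show "primeideal (Q i) mpoly_ring" if "i \<le> 3" for i
          using Q(1) \<open>\<not> n \<le> 2\<close> that by simp
        show "Q i \<subset> Q (Suc i)" if "i < 3" for i
          using Q(2) \<open>\<not> n \<le> 2\<close> that by simp
      qed simp
    qed
    then show "enat n \<le> 2" by (simp add: numeral_eq_enat)
  qed
  moreover have "2 \<in> ?S"
  proof -
    obtain A where "indep A E" "card A = 2"
      using independence_number_attained E by metis
    then obtain u v where uv: "u \<noteq> v" "{u, v} \<notin> E"
      by (auto simp: card_2_iff indep_def)
    define h :: "'k \<Rightarrow> 'k poly poly" where "h a = [:[:a:]:]" for a
    \<comment> \<open>The outer indeterminate is the image of \<open>u\<close>, the inner one that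
      of \<open>v\<close>; thus one \<open>poly _ 0\<close> kills \<open>u\<close> and a second one
      kills \<open>v\<close>.\<close>
    define g :: "'v \<Rightarrow> 'k poly poly" where
      "g w = (if w = u then [:0, 1:] else if w = v then [:[:0, 1:]:] else 0)" for w
    let ?ev = "eval_mpoly h g :: ('v, 'k) mpoly \<Rightarrow> 'k poly poly"
    define P0 where "P0 = {p. id (?ev p) = 0}"
    define P1 where "P1 = {p. poly (?ev p) 0 = 0}"
    define P2 where "P2 = {p. poly (poly (?ev p) 0) 0 = 0}"
    have h: "\<And>a b. h (a + b) = h a + h b" "\<And>a b. h (a * b) = h a * h b" "h 1 = 1"
      by (auto simp: h_def one_pCons)
    have prime: "primeideal P0 mpoly_ring" "primeideal P1 mpoly_ring" "primeideal P2 mpoly_ring"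
      unfolding P0_def P1_def P2_def by (rule primeideal_eval_kernel; simp add: h)+
    have Var: "?ev (Var w) = g w" for w by (simp add: eval_mpoly_Var h)
    have "?ev (Var a * Var b) = 0" if "{a, b} \<in> E" for a b
    proof -
      \<comment> \<open>Only \<open>u\<close> and \<open>v\<close> have nonzero images and they are
        not adjacent; the leftover case \<open>a = b\<close> is excluded since edges have two
        elements.\<close>
      have "g a = 0 \<or> g b = 0 \<or> a = b"
        using that uv by (auto simp: g_def insert_commute)
      moreover have "a \<noteq> b"
        using that simple unfolding simple_graph_def by auto
      ultimately show ?thesis by (auto simp: eval_mpoly_mult h Var)
    qed
    then have I0: "?I \<subseteq> P0"
      by (subst edge_ideal_subset_iff[OF mpoly_prime_ideal[OF prime(1)]]) (simp add: P0_def)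
    have "P0 \<subseteq> P1" "P1 \<subseteq> P2" by (auto simp: P0_def P1_def P2_def)
    moreover have "Var u \<in> P1 - P0" "Var v \<in> P2 - P1"
      using uv by (auto simp: P0_def P1_def P2_def Var g_def)
    ultimately have "P0 \<subset> P1" "P1 \<subset> P2" by blast+
    define Q where "Q i = [P0, P1, P2] ! i" for i
    have "(\<forall>i\<le>2. primeideal (Q i) mpoly_ring \<and> ?I \<subseteq> Q i) \<and> (\<forall>i<2. Q i \<subset> Q (Suc i))"
      using prime I0 \<open>P0 \<subset> P1\<close> \<open>P1 \<subset> P2\<close>
      by (auto simp: Q_def less_Suc_eq numeral_2_eq_2 le_Suc_eq)
    then show ?thesis unfolding numeral_eq_enat by blast
  qed
  then have "2 \<le> Sup ?S" by (rule Sup_upper)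
  ultimately show ?thesis by (simp add: dim antisym)
qed

section \<open>Zero-one parameters and clique partitions\<close>

text \<open>A point supported on a non-edge is a zero of the edge ideal. If the forms vanish there
  too, so does the power of each variable that lies in the ideal they generate together. With
  \<open>u = v\<close> this speaks about a single vertex.\<close>

lemma radical_zero_point:
  fixes E :: "'v::finite set set" and fs :: "('v, 'k::field) mpoly list"
  assumes E: "simple_graph E" and uv: "{u, v} \<notin> E"
    and rad: "radical mpoly_ring (Idl\<^bsub>mpoly_ring\<^esub> (edge_ideal E \<union> set fs)) = irrelevant_ideal"
    and z: "\<And>w. w \<noteq> u \<Longrightarrow> w \<noteq> v \<Longrightarrow> z w = 0"
    and fs: "\<And>f. f \<in> set fs \<Longrightarrow> eval_mpoly id z f = 0"
  shows "z w = 0"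
proof -
  let ?Z = "{p :: ('v, 'k) mpoly. eval_mpoly id z p = 0}"
  have Z: "ideal ?Z mpoly_ring"
    by (rule ideal_mpoly_ringI) (simp_all add: eval_mpoly_zero eval_mpoly_add eval_mpoly_mult)
  have "z a = 0 \<or> z b = 0" if "{a, b} \<in> E" for a b
    using z uv E that unfolding simple_graph_def
    by (metis card_2_iff doubleton_eq_iff insert_absorb2)
  then have "edge_ideal E \<subseteq> ?Z"
    by (subst edge_ideal_subset_iff[OF Z]) (auto simp: eval_mpoly_mult eval_mpoly_Var)
  then have "Idl\<^bsub>mpoly_ring\<^esub> (edge_ideal E \<union> set fs) \<subseteq> ?Z"
    unfolding Idl_subset_iff[OF Z] using fs by auto
  moreover have "Var w \<in> radical mpoly_ring (Idl\<^bsub>mpoly_ring\<^esub> (edge_ideal E \<union> set fs))"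
    using rad Var_in_irrelevant_ideal by blast
  ultimately obtain n where "eval_mpoly id z (Var w ^ n :: ('v, 'k) mpoly) = 0"
    by (auto simp: radical_mpoly_ring)
  then show ?thesis by (simp add: eval_mpoly_power eval_mpoly_Var)
qed

lemma eval_linear_form:
  fixes z :: "'v::finite \<Rightarrow> 'k::field"
  shows "eval_mpoly id z (\<Sum>v\<in>UNIV. Const (c v) * Var v) = (\<Sum>v\<in>UNIV. c v * z v)"
  by (simp add: eval_mpoly_sum eval_mpoly_mult eval_mpoly_Const eval_mpoly_Var)

text \<open>Turns the 0-1 condition on a polynomial into one on the coefficient function of its
  linear form.\<close>

lemma lookup_linear_form:
  "Poly_Mapping.lookup (\<Sum>v\<in>UNIV. Const (c v) * Var v :: ('v::finite, 'k::field) mpoly) (Poly_Mapping.single u 1) = c u"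
proof -
  have "Poly_Mapping.single u (1::nat) = Poly_Mapping.single v 1 \<longleftrightarrow> u = v" for u v :: 'v
    by (metis lookup_single_eq lookup_single_not_eq zero_neq_one)
  then show ?thesis by (simp add: lookup_sum lookup_Const_mult lookup_Var if_distrib cong: if_cong)
qed

lemma zero_one_sop_imp_clique_partition:
  fixes E :: "'v::finite set set"
  assumes E: "simple_graph E" "independence_number E = 2"
    and sop: "zero_one_linear_sop (edge_ideal E :: ('v, 'k::field) mpoly set) fs"
  shows "\<exists>P. clique_partition E P \<and> (card P = 3 \<or> card P = 2)"
proof -
  have lin: "\<forall>f\<in>set fs. linear_form f" and "enat (length fs) = 2"
    and rad: "radical mpoly_ring (Idl\<^bsub>mpoly_ring\<^esub> (edge_ideal E \<union> set fs)) = irrelevant_ideal"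
    and zo: "\<forall>f\<in>set fs. \<forall>m. Poly_Mapping.lookup f m \<in> {0, 1}"
    using sop krull_dim_edge_ring[OF E, where 'k = 'k]
    unfolding zero_one_linear_sop_def linear_sop_def by auto
  then have "length fs = 2" by (simp add: numeral_eq_enat)
  then obtain f1 f2 where fs: "fs = [f1, f2]"
    by (auto simp: numeral_2_eq_2 length_Suc_conv)
  obtain c1 c2 where c: "f1 = (\<Sum>v\<in>UNIV. Const (c1 v) * Var v)" "f2 = (\<Sum>v\<in>UNIV. Const (c2 v) * Var v)"
    using lin by (auto simp: fs linear_form_def)
  define w where "w v = (c1 v, c2 v)" for v
  have zero_one: "c1 v \<in> {0, 1}" "c2 v \<in> {0, 1}" for v
  proof -
    have "Poly_Mapping.lookup f1 (Poly_Mapping.single v 1) \<in> {0, 1}"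
      "Poly_Mapping.lookup f2 (Poly_Mapping.single v 1) \<in> {0, 1}"
      using zo by (simp_all add: fs)
    then show "c1 v \<in> {0, 1}" "c2 v \<in> {0, 1}"
      unfolding c lookup_linear_form by blast+
  qed
  have point: "z u = 0"
    if "{u, v} \<notin> E" "\<And>x. x \<noteq> u \<Longrightarrow> x \<noteq> v \<Longrightarrow> z x = 0"
      "(\<Sum>x\<in>UNIV. c1 x * z x) = 0" "(\<Sum>x\<in>UNIV. c2 x * z x) = 0" for u v z
  proof (rule radical_zero_point[OF E(1) that(1) rad that(2)])
    show "eval_mpoly id z f = 0" if "f \<in> set fs" for f
      using that \<open>(\<Sum>x\<in>UNIV. c1 x * z x) = 0\<close> \<open>(\<Sum>x\<in>UNIV. c2 x * z x) = 0\<close>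
      by (auto simp: fs c eval_linear_form)
  qed
  \<comment> \<open>Otherwise the indicator of \<open>v\<close> would be a nontrivial common
    zero.\<close>
  have nonzero: "w v \<noteq> (0, 0)" for v
  proof
    assume w0: "w v = (0, 0)"
    have "{v, v} \<notin> E" using E(1) by (auto simp: simple_graph_def)
    from point[OF this, of "\<lambda>x. if x = v then 1 else 0"] w0 show False
      by (simp add: w_def if_distrib cong: if_cong)
  qed
  have distinct: "{u, v} \<in> E" if "u \<noteq> v" "w u = w v" for u v
  proof (rule ccontr)
    assume uv: "{u, v} \<notin> E"
    \<comment> \<open>With equal coefficient vectors at \<open>u\<close> and \<open>v\<close>, the
      difference of the two unit vectors is a zero of both forms.\<close>
    define z :: "'v \<Rightarrow> 'k" where "z = (\<lambda>x. if x = u then 1 else if x = v then -1 else 0)"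
    have "(\<Sum>x\<in>UNIV. c x * z x) = c u - c v" for c :: "'v \<Rightarrow> 'k"
    proof -
      have "(\<Sum>x\<in>UNIV. c x * z x) = (\<Sum>x\<in>UNIV. (if x = u then c u else 0) + (if x = v then - c v else 0))"
        using \<open>u \<noteq> v\<close> by (intro sum.cong) (auto simp: z_def)
      then show ?thesis by (simp add: sum.distrib)
    qed
    from point[OF uv, of z] this show False using that by (simp add: z_def w_def)
  qed
  let ?W = "{(1, 0), (0, 1), (1, 1)} :: ('k \<times> 'k) set"
  \<comment> \<open>The blocks are the nonempty fibres of \<open>w\<close>, at most one for each of
    the three vectors in \<open>?W\<close>.\<close>
  define P where "P = range (\<lambda>v. w -` {w v})"
  have W: "w v \<in> ?W" for v using zero_one[of v] nonzero[of v] by (auto simp: w_def)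
  have "partition_on UNIV P"
    by (rule partition_onI) (auto simp: P_def disjnt_def)
  moreover have cl: "clique A E" if "A \<in> P" for A
    using that distinct by (auto simp: P_def clique_def)
  ultimately have "clique_partition E P" by (simp add: clique_partition_def)
  moreover have "card P \<le> 3"
  proof -
    have "P \<subseteq> (\<lambda>a. w -` {a}) ` ?W" unfolding P_def using W by blast
    then have "card P \<le> card ((\<lambda>a. w -` {a}) ` ?W)" by (intro card_mono) auto
    also have "\<dots> \<le> card ?W" by (intro card_image_le) auto
    finally show ?thesis by simp
  qed
  \<comment> \<open>Two non-adjacent vertices exist and lie in different fibres, which excludes a
    single block.\<close>
  moreover have "card P > 1"
  proof -
    obtain A where A: "indep A E" "card A = 2" using independence_number_attained E(2) by metis
    then obtain u v where uv: "u \<noteq> v" "{u, v} \<notin> E" by (auto simp: card_2_iff indep_def)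
    then have "w -` {w u} \<noteq> w -` {w v}" using distinct by blast
    moreover have "{w -` {w u}, w -` {w v}} \<subseteq> P" by (auto simp: P_def)
    then have "card {w -` {w u}, w -` {w v}} \<le> card P" by (intro card_mono) auto
    ultimately show ?thesis by simp
  qed
  ultimately show ?thesis by (intro exI[of _ P]) auto
qed

section \<open>From clique partitions to colourings and parameters\<close>

text \<open>The colour of a vertex is the number of its block. Since \<open>n\<close> may exceed the
  number of blocks, two cliques also yield a colouring with values below 3.\<close>

lemma clique_partition_imp_colouring:
  fixes E :: "'v::finite set set"
  assumes "clique_partition E P" "card P \<le> n"
  obtains c :: "'v \<Rightarrow> nat" where "\<And>v. c v < n" "\<And>u v. u \<noteq> v \<Longrightarrow> c u = c v \<Longrightarrow> {u, v} \<in> E"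
proof -
  have part: "partition_on UNIV P" and cl: "\<And>A. A \<in> P \<Longrightarrow> clique A E"
    using assms by (auto simp: clique_partition_def)
  obtain i where i: "inj_on i P" "i ` P = {..<card P}"
    using ex_bij_betw_finite_nat[of P] by (metis finite atLeast0LessThan bij_betw_def)
  have "\<exists>A\<in>P. v \<in> A" for v using partition_onD1[OF part] by blast
  then obtain b where b: "\<And>v. b v \<in> P \<and> v \<in> b v" by metis
  show thesis
  proof
    fix v show "i (b v) < n" 
    proof -
      have "i (b v) \<in> i ` P" using b by blast
      then show ?thesis using i(2) assms(2) by simp
    qed
  next
    fix u v assume "u \<noteq> v" "i (b u) = i (b v)"
    then have "b u = b v" using b i(1) by (meson inj_onD)
    then show "{u, v} \<in> E" using cl[of "b u"] b[of u] b[of v] \<open>u \<noteq> v\<close> by (auto simp: clique_def)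
  qed
qed

text \<open>Distinct vertices of one colour are adjacent in the graph, hence not in the complement,
  so the same colouring is proper there.\<close>

lemma chromatic_number_complement_le:
  fixes E :: "'v::finite set set"
  assumes "clique_partition E P"
  shows "chromatic_number (complement_graph E) \<le> card P"
proof -
  obtain c :: "'v \<Rightarrow> nat" where c: "\<And>v. c v < card P" "\<And>u v. u \<noteq> v \<Longrightarrow> c u = c v \<Longrightarrow> {u, v} \<in> E"
    using clique_partition_imp_colouring[OF assms le_refl] by blast
  have "u \<noteq> v \<and> {u, v} \<notin> E" if "{u, v} \<in> complement_graph E" for u v
    using that by (auto simp: complement_graph_def)
  then show ?thesis
    unfolding chromatic_number_def by (intro Least_le) (use c in blast)
qed

text \<open>With \<open>s\<^sub>i\<close> the sum of the \<open>i\<close>-th clique, \<open>s\<^sub>0 + s\<^sub>2\<close> and \<open>s\<^sub>1 + s\<^sub>2\<close> are parameters: modulo them all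
  \<open>s\<^sub>i\<^sup>3\<close> agree up to sign with \<open>s\<^sub>0 s\<^sub>1 s\<^sub>2\<close>, which lies in the edge ideal because no three vertices are
  independent, while \<open>x\<^sup>2\<close> and \<open>x s\<^sub>i\<close> are congruent modulo the edge ideal for \<open>x\<close> in the \<open>i\<close>-th clique.\<close>

lemma clique_partition_imp_zero_one_sop:
  fixes E :: "'v::finite set set"
  assumes E: "simple_graph E" "independence_number E = 2"
    and P: "clique_partition E P" "card P \<le> 3"
  shows "\<exists>fs. zero_one_linear_sop (edge_ideal E :: ('v, 'k::field) mpoly set) fs"
proof -
  obtain c :: "'v \<Rightarrow> nat" where c3: "\<And>v. c v < 3" and c: "\<And>u v. u \<noteq> v \<Longrightarrow> c u = c v \<Longrightarrow> {u, v} \<in> E"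
    using clique_partition_imp_colouring[OF P] by blast
  let ?x = "Var :: 'v \<Rightarrow> ('v, 'k) mpoly" and ?I = "edge_ideal E :: ('v, 'k) mpoly set"
  \<comment> \<open>A colour class may be empty and its sum 0, which covers partitions with fewer
    than three cliques.\<close>
  define s where "s i = (\<Sum>v | c v = i. ?x v)" for i
  define f1 where "f1 = s 0 + s 2"
  define f2 where "f2 = s 1 + s 2"
  define J where "J = Idl\<^bsub>mpoly_ring\<^esub> (?I \<union> set [f1, f2])"
  have J: "ideal J mpoly_ring" unfolding J_def by (rule ideal_Idl)
  have "?I \<union> set [f1, f2] \<subseteq> J" unfolding J_def by (rule subset_Idl)
  then have IJ: "?I \<subseteq> J" and fJ: "f1 \<in> J" "f2 \<in> J" by auto
  have edge: "?x u * ?x v \<in> J" if "{u, v} \<in> E" for u v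
    using edge_in_edge_ideal[OF that] IJ by blast
  \<comment> \<open>Different colour classes are disjoint, so no variable receives the coefficient 1
    twice.\<close>
  have form: "s i + s j = (\<Sum>v\<in>UNIV. Const (if c v = i \<or> c v = j then 1 else 0) * ?x v)" if "i \<noteq> j" for i j
  proof -
    have "s i + s j = (\<Sum>v\<in>{v. c v = i} \<union> {v. c v = j}. ?x v)"
      unfolding s_def using that by (intro sum.union_disjoint[symmetric]) auto
    also have "\<dots> = (\<Sum>v\<in>UNIV. if v \<in> {v. c v = i} \<union> {v. c v = j} then ?x v else 0)"
      by (simp add: sum.If_cases Un_def)
    finally show ?thesis by (auto intro!: sum.cong)
  qed
  have lin: "linear_form (s i + s j)" and zo: "Poly_Mapping.lookup (s i + s j) m \<in> {0, 1}" if "i \<noteq> j" for i j m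
  proof -
    show "linear_form (s i + s j)" unfolding linear_form_def form[OF that] by (rule exI[of _ "\<lambda>v. if c v = i \<or> c v = j then 1 else 0"]) simp
    have eq: "Poly_Mapping.lookup (s i + s j) m = (\<Sum>v\<in>UNIV. (if c v = i \<or> c v = j then 1 else 0) *
        (if m = Poly_Mapping.single v 1 then 1 else 0))"
      by (simp add: form[OF that] lookup_sum lookup_Const_mult lookup_Var)
    show "Poly_Mapping.lookup (s i + s j) m \<in> {0, 1}"
    proof (cases "\<exists>u. m = Poly_Mapping.single u 1")
      case True
      then obtain u where "m = Poly_Mapping.single u 1" by blast
      then show ?thesis
        using lookup_linear_form[of "\<lambda>v. if c v = i \<or> c v = j then 1 else (0::'k)" u] by (simp add: form[OF that])
    next
      case False
      then show ?thesis by (simp add: eq)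
    qed
  qed
  have "s 0 * s 1 * s 2 \<in> J"
  proof -
    have "?x u * ?x v * ?x w \<in> J" if "c u = 0" "c v = 1" "c w = 2" for u v w
    proof -
      have "u \<noteq> v" "u \<noteq> w" "v \<noteq> w" using that by auto
      then have "card {u, v, w} = 3" by simp
      then have "\<not> indep {u, v, w} E" using independence_number_ge[of "{u, v, w}" E] E(2) by auto
      then have "{u, v} \<in> E \<or> {u, w} \<in> E \<or> {v, w} \<in> E"
        by (auto simp: indep_def insert_commute)
      then show ?thesis
        using mpoly_ideal_mult[OF J edge, of u v "?x w"] mpoly_ideal_mult[OF J edge, of u w "?x v"]
          mpoly_ideal_mult[OF J edge, of v w "?x u"] by (auto simp: mult_ac)
    qed
    then show ?thesis
      unfolding s_def sum_distrib_left sum_distrib_right by (intro mpoly_ideal_sum[OF J]) auto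
  qed
  have s2: "s 2 ^ 3 \<in> J"
  proof -
    \<comment> \<open>Modulo \<open>f1\<close> and \<open>f2\<close> both \<open>s 0\<close> and
      \<open>s 1\<close> equal \<open>- s 2\<close>, so \<open>s 0 * s 1 * s 2\<close> becomes
      \<open>s 2 ^ 3\<close>.\<close>
    have "s 2 ^ 3 = s 0 * s 1 * s 2 + f1 * (s 2 * s 2) - f2 * (s 0 * s 2)"
      by (simp add: f1_def f2_def power3_eq_cube algebra_simps)
    then show ?thesis
      using \<open>s 0 * s 1 * s 2 \<in> J\<close> fJ
      by (auto intro!: mpoly_ideal_diff[OF J] mpoly_ideal_add[OF J] mpoly_ideal_mult_right[OF J])
  qed
  have cube: "s i ^ 3 \<in> J" if "i < 3" for i
  proof -
    have step: "s i ^ 3 \<in> J" if "s i + s 2 \<in> J" for i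
    proof -
      \<comment> \<open>The factorisation of a sum of two cubes.\<close>
      have "s i ^ 3 = (s i + s 2) * (s i * s i - s i * s 2 + s 2 * s 2) - s 2 ^ 3"
        by (simp add: power3_eq_cube algebra_simps)
      then show ?thesis using that s2 by (auto intro!: mpoly_ideal_diff[OF J] mpoly_ideal_mult_right[OF J])
    qed
    from that have "i = 0 \<or> i = 1 \<or> i = 2" by auto
    then show ?thesis using s2 step[of 0] step[of 1] fJ by (auto simp: f1_def f2_def)
  qed
  have Var_rad: "?x v \<in> radical mpoly_ring J" for v
  proof -
    let ?s = "s (c v)"
    have "?s = ?x v + (\<Sum>u\<in>{u. c u = c v} - {v}. ?x u)"
      unfolding s_def by (intro sum.remove) auto
    then have "?x v * ?s - ?x v ^ 2 = (\<Sum>u\<in>{u. c u = c v} - {v}. ?x v * ?x u)"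
      by (simp add: distrib_left sum_distrib_left power2_eq_square)
    moreover have "\<dots> \<in> J"
      by (intro mpoly_ideal_sum[OF J] edge c) auto
    ultimately have d: "?x v * ?s - ?x v ^ 2 \<in> J" by simp
    \<comment> \<open>With \<open>x\<close> the variable, the product on the right is
      \<open>x * (?s ^ 3 - x ^ 3)\<close>, the factorised difference of two cubes times
      \<open>x\<close>.\<close>
    have "?x v ^ 4 = ?x v * ?s ^ 3 - (?x v * ?s - ?x v ^ 2) * (?x v ^ 2 + ?x v * ?s + ?s ^ 2)"
      by (simp add: algebra_simps eval_nat_numeral)
    then have "?x v ^ 4 \<in> J"
      using d cube[OF c3] mpoly_ideal_diff[OF J] mpoly_ideal_mult[OF J] mpoly_ideal_mult_right[OF J] by simp
    then show ?thesis unfolding radical_mpoly_ring by blast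
  qed
  have "J \<subseteq> irrelevant_ideal"
    unfolding J_def Idl_subset_iff[OF irrelevant_ideal_ideal] Un_subset_iff
      edge_ideal_subset_iff[OF irrelevant_ideal_ideal]
    by (auto simp: f1_def f2_def s_def Var_in_irrelevant_ideal
        intro!: mpoly_ideal_mult mpoly_ideal_add mpoly_ideal_sum irrelevant_ideal_ideal)
  moreover have "irrelevant_ideal \<subseteq> radical mpoly_ring J"
    unfolding irrelevant_ideal_def Idl_subset_iff[OF ideal_radical[OF J]] using Var_rad by blast
  ultimately have "radical mpoly_ring J = irrelevant_ideal"
    using radical_subset_irrelevant_ideal by blast
  then have "linear_sop ?I [f1, f2]"
    unfolding linear_sop_def krull_dim_edge_ring[OF E] using lin
    by (auto simp: J_def f1_def f2_def numeral_eq_enat)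
  then have "zero_one_linear_sop ?I [f1, f2]"
    unfolding zero_one_linear_sop_def using zo[of 0 2] zo[of 1 2] by (simp add: f1_def f2_def)
  then show ?thesis by blast
qed

theorem proposition4p5:
  fixes E :: "'v::finite set set"
  assumes "simple_graph E"
    and "independence_number E = 2"
  shows "((\<exists>fs. zero_one_linear_sop (edge_ideal E :: ('v, 'k::field) mpoly set) fs) \<longleftrightarrow>
            (\<exists>P. clique_partition E P \<and> (card P = 3 \<or> card P = 2)))
       \<and> (chromatic_number (complement_graph E) > 3 \<longrightarrow>
            \<not> (\<exists>fs. zero_one_linear_sop (edge_ideal E :: ('v, 'k) mpoly set) fs))"
proof -
  have iff: "(\<exists>fs. zero_one_linear_sop (edge_ideal E :: ('v, 'k) mpoly set) fs) \<longleftrightarrow>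
      (\<exists>P. clique_partition E P \<and> (card P = 3 \<or> card P = 2))"
    using zero_one_sop_imp_clique_partition[OF assms] clique_partition_imp_zero_one_sop[OF assms]
    by (metis eq_refl numeral_le_iff semiring_norm(69) semiring_norm(72))
  \<comment> \<open>Two or three cliques would colour the complement with at most three colours, so
    a larger chromatic number excludes such partitions and, by the equivalence, the
    parameters.\<close>
  moreover have "\<not> chromatic_number (complement_graph E) > 3"
    if "clique_partition E P" "card P = 3 \<or> card P = 2" for P
    using chromatic_number_complement_le[OF that(1)] that(2) by auto
  ultimately show ?thesis by blast
qed

end
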